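(* Let $G$ be a finite undirected graph (multiple edges and loops allowed), and let $\mathcal I$ be the poset of ideals of $\mathrm{Iisg}(G)$ ordered by inclusion. Then $\mathcal I$ is semimodular, but if $G$ contains more than $2$ vertices, then $\mathcal I$ is not atomic.
   Context: Graphs are finite and undirected and may have multiple edges and loops; the empty graph $\emptyset$ counts as a graph and the empty map $\mu_0:\emptyset\to\emptyset$ counts as a graph isomorphism. For a graph $G$, $\mathrm{Iisg}(G)$ is the set of all graph isomorphisms $\varphi:H\to J$ (bijections on vertices and on edges preserving incidence) where $H$ and $J$ are vertex induced subgraphs of $G$. For $\varphi,\psi\in\mathrm{Iisg}(G)$ the product $\psi\circ\varphi$ is the composition of partial maps, with domain $\varphi^{-1}(\mathrm{Im}(\varphi)\cap\mathrm{Dom}(\psi))$ and image $\psi(\mathrm{Im}(\varphi)\cap\mathrm{Dom}(\psi))$. An ideal of a semigroup $S$ is a subset $I\subseteq S$ with $SI\subseteq I$ and $IS\subseteq I$. The poset of ideals is a lattice with meet $\cap$ and join $\cup$. A lattice is semimodular if, for all $A,B$, whenever $A$ covers $A\wedge B$, then $A\vee B$ covers $B$. A finite lattice is atomic if every element is a join of atoms (elements covering the least element; the least element is the empty join). *)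

theory Defs
  imports "HOL-Algebra.Lattice" "HOL-Algebra.Group"
begin

section \<open>Finite undirected multigraphs\<close>

text \<open>
  Each edge carries its set of end vertices, which has two elements for a proper edge and
  one element for a loop. Different edges may have the same ends.
\<close>

record ('v, 'e) multigraph =
  verts :: "'v set"
  edges :: "'e set"
  ends  :: "'e \<Rightarrow> 'v set"

locale finite_multigraph =
  fixes G :: "('v, 'e) multigraph" (structure)
  assumes finite_verts: "finite (verts G)"
    and finite_edges: "finite (edges G)"
    and ends_subset: "e \<in> edges G \<Longrightarrow> ends G e \<subseteq> verts G"
    and ends_card: "e \<in> edges G \<Longrightarrow> card (ends G e) = 1 \<or> card (ends G e) = 2"

definition induced_subgraph :: "('v, 'e) multigraph \<Rightarrow> 'v set \<Rightarrow> ('v, 'e) multigraph" where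
  "induced_subgraph G U =
     \<lparr>verts = U, edges = {e \<in> edges G. ends G e \<subseteq> U}, ends = ends G\<rparr>"


section \<open>The semigroup of isomorphisms between induced subgraphs\<close>

text \<open>
  A partial map of graphs is a pair of partial functions, one on vertices and one on edges.
  An isomorphism \<open>H \<rightarrow> J\<close> is such a pair defined exactly on \<open>H\<close>, so that isomorphisms between
  different subgraphs are different as pairs, and equality of pairs is equality of maps.
\<close>

type_synonym ('v, 'e) partial_graph_map = "('v \<rightharpoonup> 'v) \<times> ('e \<rightharpoonup> 'e)"

definition graph_iso ::
  "('v, 'e) multigraph \<Rightarrow> ('v, 'e) multigraph \<Rightarrow> ('v, 'e) partial_graph_map \<Rightarrow> bool" where
  "graph_iso H J \<phi> \<longleftrightarrow>
     dom (fst \<phi>) = verts H \<and> bij_betw (\<lambda>v. the (fst \<phi> v)) (verts H) (verts J) \<and>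
     dom (snd \<phi>) = edges H \<and> bij_betw (\<lambda>e. the (snd \<phi> e)) (edges H) (edges J) \<and>
     (\<forall>e \<in> edges H. ends J (the (snd \<phi> e)) = (\<lambda>v. the (fst \<phi> v)) ` ends H e)"

text \<open>
  The product is composition of partial maps, \<open>\<psi> \<otimes> \<phi>\<close> being \<open>\<psi>\<close> after \<open>\<phi>\<close>; its domain is
  the preimage under \<open>\<phi>\<close> of the common part of the image of \<open>\<phi>\<close> and the domain of \<open>\<psi>\<close>.
  The subgraphs induced on the empty set contribute the empty map.
\<close>

definition Iisg :: "('v, 'e) multigraph \<Rightarrow> ('v, 'e) partial_graph_map monoid" where
  "Iisg G =
     \<lparr>carrier = {\<phi>. \<exists>U W. U \<subseteq> verts G \<and> W \<subseteq> verts G \<and>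
                     graph_iso (induced_subgraph G U) (induced_subgraph G W) \<phi>},
      mult = (\<lambda>\<psi> \<phi>. (fst \<psi> \<circ>\<^sub>m fst \<phi>, snd \<psi> \<circ>\<^sub>m snd \<phi>)),
      one = (Some |` verts G, Some |` edges G)\<rparr>"


section \<open>Ideals of a semigroup\<close>

text \<open>
  The empty set satisfies both inclusions, hence is an ideal. The unit of the record is not used.
\<close>

definition semigroup_ideal :: "('a, 'b) monoid_scheme \<Rightarrow> 'a set \<Rightarrow> bool" where
  "semigroup_ideal S I \<longleftrightarrow>
     I \<subseteq> carrier S \<and>
     (\<forall>s \<in> carrier S. \<forall>x \<in> I. s \<otimes>\<^bsub>S\<^esub> x \<in> I \<and> x \<otimes>\<^bsub>S\<^esub> s \<in> I)"

definition ideal_poset :: "('a, 'b) monoid_scheme \<Rightarrow> 'a set gorder" where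
  "ideal_poset S = \<lparr>carrier = {I. semigroup_ideal S I}, eq = (=), le = (\<subseteq>)\<rparr>"


section \<open>Semimodular and atomic lattices\<close>

text \<open>\<open>covers L x y\<close>: the element \<open>x\<close> covers \<open>y\<close>.\<close>

definition covers :: "('a, 'b) gorder_scheme \<Rightarrow> 'a \<Rightarrow> 'a \<Rightarrow> bool" where
  "covers L x y \<longleftrightarrow>
     x \<in> carrier L \<and> y \<in> carrier L \<and> y \<sqsubset>\<^bsub>L\<^esub> x \<and>
     \<not> (\<exists>z \<in> carrier L. y \<sqsubset>\<^bsub>L\<^esub> z \<and> z \<sqsubset>\<^bsub>L\<^esub> x)"

locale semimodular_lattice = lattice L for L (structure) +
  assumes semimodular:
    "\<lbrakk>A \<in> carrier L; B \<in> carrier L; covers L A (A \<sqinter> B)\<rbrakk> \<Longrightarrow> covers L (A \<squnion> B) B"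

definition atoms :: "('a, 'b) gorder_scheme \<Rightarrow> 'a set" where
  "atoms L = {a. covers L a \<bottom>\<^bsub>L\<^esub>}"

text \<open>
  Joins are expressed as least upper bounds. The join of the empty set of atoms is the
  least element, since \<open>Upper L {}\<close> is the whole carrier.
\<close>

definition atomic :: "('a, 'b) gorder_scheme \<Rightarrow> bool" where
  "atomic L \<longleftrightarrow> (\<forall>x \<in> carrier L. \<exists>T \<subseteq> atoms L. least L x (Upper L T))"

end

theory Submission
  imports Defs
begin

text \<open>
  The ideals of a semigroup form a sublattice of its powerset, because they are closed under
  unions and intersections; so the lattice is distributive, hence semimodular. The empty map is a
  zero of the semigroup, so it lies in every nonempty ideal, and its singleton is the only atom
  (the least element being the empty ideal). Hence the whole semigroup is not a join of atoms as
  soon as it contains a nonempty map.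
\<close>

section \<open>The lattice of ideals\<close>

lemma carrier_ideal_poset [simp]: "I \<in> carrier (ideal_poset S) \<longleftrightarrow> semigroup_ideal S I"
  and eq_ideal_poset [simp]: "x .=\<^bsub>ideal_poset S\<^esub> y \<longleftrightarrow> x = y"
  and le_ideal_poset [simp]: "x \<sqsubseteq>\<^bsub>ideal_poset S\<^esub> y \<longleftrightarrow> x \<subseteq> y"
  and lless_ideal_poset [simp]: "x \<sqsubset>\<^bsub>ideal_poset S\<^esub> y \<longleftrightarrow> x \<subset> y"
  by (auto simp: ideal_poset_def lless_def)

lemma semigroup_ideal_empty [simp]: "semigroup_ideal S {}"
  by (simp add: semigroup_ideal_def)

lemma semigroup_ideal_Un:
  "semigroup_ideal S I \<Longrightarrow> semigroup_ideal S J \<Longrightarrow> semigroup_ideal S (I \<union> J)"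
  by (auto simp: semigroup_ideal_def)

lemma semigroup_ideal_Int:
  "semigroup_ideal S I \<Longrightarrow> semigroup_ideal S J \<Longrightarrow> semigroup_ideal S (I \<inter> J)"
  by (auto simp: semigroup_ideal_def)

lemma partial_order_ideal_poset: "partial_order (ideal_poset S)"
  by unfold_locales (auto simp: fun_eq_iff)

lemma least_Upper_ideal_poset:
  "semigroup_ideal S A \<Longrightarrow> semigroup_ideal S B \<Longrightarrow>
    least (ideal_poset S) (A \<union> B) (Upper (ideal_poset S) {A, B})"
  by (auto simp: least_def Upper_def semigroup_ideal_Un)

lemma greatest_Lower_ideal_poset:
  "semigroup_ideal S A \<Longrightarrow> semigroup_ideal S B \<Longrightarrow>
    greatest (ideal_poset S) (A \<inter> B) (Lower (ideal_poset S) {A, B})"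
  by (auto simp: greatest_def Lower_def semigroup_ideal_Int)

lemma lattice_ideal_poset: "lattice (ideal_poset S)"
proof -
  interpret partial_order "ideal_poset S" by (rule partial_order_ideal_poset)
  show ?thesis
    by unfold_locales (use least_Upper_ideal_poset greatest_Lower_ideal_poset in fastforce)+
qed

text \<open>The library join is a Hilbert choice among least upper bounds; antisymmetry of inclusion
  makes that choice unique, so it must be the union. Meets are identified dually.\<close>

lemma join_ideal_poset:
  assumes "semigroup_ideal S A" "semigroup_ideal S B"
  shows "A \<squnion>\<^bsub>ideal_poset S\<^esub> B = A \<union> B"
proof -
  interpret partial_order "ideal_poset S" by (rule partial_order_ideal_poset)
  show ?thesis
    unfolding join_def sup_def using least_Upper_ideal_poset[OF assms]
    by (rule some_equality) (rule least_unique[OF _ least_Upper_ideal_poset[OF assms]])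
qed

lemma meet_ideal_poset:
  assumes "semigroup_ideal S A" "semigroup_ideal S B"
  shows "A \<sqinter>\<^bsub>ideal_poset S\<^esub> B = A \<inter> B"
proof -
  interpret partial_order "ideal_poset S" by (rule partial_order_ideal_poset)
  show ?thesis
    unfolding meet_def inf_def using greatest_Lower_ideal_poset[OF assms]
    by (rule some_equality) (rule greatest_unique[OF _ greatest_Lower_ideal_poset[OF assms]])
qed

text \<open>Since the empty set is an ideal, the bottom lies strictly below the ideal formed by a
  zero, which can therefore be an atom.\<close>

lemma bottom_ideal_poset: "\<bottom>\<^bsub>ideal_poset S\<^esub> = {}"
  unfolding bottom_def
  by (rule some_equality) (use semigroup_ideal_empty in \<open>auto simp: least_def\<close>)

lemma semimodular_ideal_poset: "semimodular_lattice (ideal_poset S)"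
proof -
  interpret lattice "ideal_poset S" by (rule lattice_ideal_poset)
  show ?thesis
  proof
    fix A B
    assume "A \<in> carrier (ideal_poset S)" "B \<in> carrier (ideal_poset S)"
      and cov: "covers (ideal_poset S) A (A \<sqinter>\<^bsub>ideal_poset S\<^esub> B)"
    then have A: "semigroup_ideal S A" and B: "semigroup_ideal S B" by auto
    have lt: "A \<inter> B \<subset> A"
      using cov by (auto simp: covers_def meet_ideal_poset[OF A B])
    have no_mid: "\<not> (A \<inter> B \<subset> Z \<and> Z \<subset> A)" if "semigroup_ideal S Z" for Z
      using cov that by (auto simp: covers_def meet_ideal_poset[OF A B])
    \<comment> \<open>Distributivity at work: \<open>Z \<inter> A\<close> would lie strictly between
      \<open>A \<inter> B\<close> and \<open>A\<close>. Indeed a point of \<open>Z\<close> outside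
      \<open>B\<close> lies in \<open>A\<close>, and \<open>A \<subseteq> Z\<close> would force
      \<open>Z = A \<union> B\<close>.\<close>
    have False if Z: "semigroup_ideal S Z" and "B \<subset> Z" "Z \<subset> A \<union> B" for Z
      using no_mid[OF semigroup_ideal_Int[OF Z A]] that by blast
    then show "covers (ideal_poset S) (A \<squnion>\<^bsub>ideal_poset S\<^esub> B) B"
      using lt A B by (fastforce simp: covers_def join_ideal_poset semigroup_ideal_Un)
  qed
qed

text \<open>Abstract form of the argument against atomicity; later \<open>z\<close> is the empty map
  and \<open>x\<close> the identity of the graph.\<close>

lemma not_atomic_ideal_poset_if_zero:
  assumes "semigroup_ideal S (carrier S)" and zero: "semigroup_ideal S {z}"
    and zero_mult: "\<And>x. x \<in> carrier S \<Longrightarrow> z \<otimes>\<^bsub>S\<^esub> x = z"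
    and x: "x \<in> carrier S" "x \<noteq> z"
  shows "\<not> atomic (ideal_poset S)"
proof
  assume "atomic (ideal_poset S)"
  then obtain T where T: "T \<subseteq> atoms (ideal_poset S)"
    and lub: "least (ideal_poset S) (carrier S) (Upper (ideal_poset S) T)"
    using assms(1) unfolding atomic_def by (metis carrier_ideal_poset)
  have "A = {z}" if "A \<in> atoms (ideal_poset S)" for A
  proof -
    have A: "semigroup_ideal S A" "A \<noteq> {}"
      and no_mid: "\<not> ({} \<subset> {z} \<and> {z} \<subset> A)"
      using that zero by (auto simp: atoms_def covers_def bottom_ideal_poset)
    \<comment> \<open>Any member \<open>y\<close> of \<open>A\<close> gives
      \<open>z = z \<otimes> y \<in> A\<close>, and an atom cannot properly contain the nonempty
      ideal \<open>{z}\<close>.\<close>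
    obtain y where y: "y \<in> A" using A(2) by blast
    moreover have "z \<in> carrier S" "y \<in> carrier S"
      using zero A(1) y by (auto simp: semigroup_ideal_def)
    ultimately have "z \<in> A"
      using A(1) zero_mult unfolding semigroup_ideal_def by metis
    then show ?thesis using no_mid by blast
  qed
  \<comment> \<open>This includes \<open>T = {}\<close>, where every ideal is an upper
    bound.\<close>
  then have "{z} \<in> Upper (ideal_poset S) T"
    using T zero by (auto simp: Upper_def)
  then have "carrier S \<subseteq> {z}"
    using lub by (auto simp: least_def)
  then show False using x by auto
qed

section \<open>The semigroup of isomorphisms between induced subgraphs\<close>

text \<open>The two vertex sets in the definition are determined by the map, as \<open>dom f\<close>
  and \<open>ran f\<close>; eliminating them leaves conditions on \<open>f\<close> and
  \<open>g\<close> alone.\<close>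

lemma Iisg_carrier_iff:
  "(f, g) \<in> carrier (Iisg G) \<longleftrightarrow>
    dom f \<subseteq> verts G \<and> ran f \<subseteq> verts G \<and> inj_on f (dom f) \<and> inj_on g (dom g) \<and>
    dom g = {e \<in> edges G. ends G e \<subseteq> dom f} \<and>
    ran g = {e \<in> edges G. ends G e \<subseteq> ran f} \<and>
    (\<forall>e e'. g e = Some e' \<longrightarrow> ends G e' = (\<lambda>v. the (f v)) ` ends G e)"
proof -
  have bij: "bij_betw (\<lambda>x. the (h x)) (dom h) R \<longleftrightarrow> inj_on h (dom h) \<and> ran h = R"
    for h :: "'c \<rightharpoonup> 'c" and R
  proof -
    have "inj_on (\<lambda>x. the (h x)) (dom h) \<longleftrightarrow> inj_on h (dom h)"
      by (force simp: inj_on_def dom_def)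
    moreover have "(\<lambda>x. the (h x)) ` dom h = ran h"
      by (force simp: ran_def dom_def image_iff)
    ultimately show ?thesis by (simp add: bij_betw_def)
  qed
  have elim_dom: "(\<exists>U W. U \<subseteq> V \<and> W \<subseteq> V \<and> dom f = U \<and> P U W) \<longleftrightarrow>
      (\<exists>W. dom f \<subseteq> V \<and> W \<subseteq> V \<and> P (dom f) W)" for V P
    by blast
  \<comment> \<open>\<open>dom g\<close> replaces the edge set of the source, so that
    \<open>bij\<close> applies to the edge map as well as to the vertex map.\<close>
  let ?iso = "\<lambda>U W. bij_betw (\<lambda>v. the (f v)) U W \<and>
      dom g = {e \<in> edges G. ends G e \<subseteq> U} \<and>
      bij_betw (\<lambda>e. the (g e)) (dom g) {e \<in> edges G. ends G e \<subseteq> W} \<and>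
      (\<forall>e \<in> dom g. ends G (the (g e)) = (\<lambda>v. the (f v)) ` ends G e)"
  have "graph_iso (induced_subgraph G U) (induced_subgraph G W) (f, g) \<longleftrightarrow> dom f = U \<and> ?iso U W"
    for U W
    unfolding graph_iso_def induced_subgraph_def fst_conv snd_conv multigraph.simps
    by metis
  then have "(f, g) \<in> carrier (Iisg G) \<longleftrightarrow>
      (\<exists>U W. U \<subseteq> verts G \<and> W \<subseteq> verts G \<and> dom f = U \<and> ?iso U W)"
    by (simp only: Iisg_def partial_object.simps mem_Collect_eq)
  also have "\<dots> \<longleftrightarrow> (\<exists>W. dom f \<subseteq> verts G \<and> W \<subseteq> verts G \<and> ?iso (dom f) W)"
    by (rule elim_dom[of "verts G" ?iso])
  also have "\<dots> \<longleftrightarrow>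
    dom f \<subseteq> verts G \<and> ran f \<subseteq> verts G \<and> inj_on f (dom f) \<and> inj_on g (dom g) \<and>
    dom g = {e \<in> edges G. ends G e \<subseteq> dom f} \<and>
    ran g = {e \<in> edges G. ends G e \<subseteq> ran f} \<and>
    (\<forall>e \<in> dom g. ends G (the (g e)) = (\<lambda>v. the (f v)) ` ends G e)"
    unfolding bij by (rule iffI; elim exE conjE; simp)
  also have "(\<forall>e \<in> dom g. ends G (the (g e)) = (\<lambda>v. the (f v)) ` ends G e) \<longleftrightarrow>
      (\<forall>e e'. g e = Some e' \<longrightarrow> ends G e' = (\<lambda>v. the (f v)) ` ends G e)"
    by (metis domD domI option.sel)
  finally show ?thesis .
qed

lemma Iisg_mult: "(f', g') \<otimes>\<^bsub>Iisg G\<^esub> (f, g) = (f' \<circ>\<^sub>m f, g' \<circ>\<^sub>m g)"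
  by (simp add: Iisg_def)

section \<open>Closure under composition of partial maps\<close>

lemma inj_on_map_comp:
  "inj_on f (dom f) \<Longrightarrow> inj_on f' (dom f') \<Longrightarrow> inj_on (f' \<circ>\<^sub>m f) (dom (f' \<circ>\<^sub>m f))"
  by (auto simp: inj_on_def dom_def map_comp_Some_iff)

text \<open>The point is that the composite edge map is defined on, and reaches, exactly the edges
  induced by the domain and range of the composite vertex map.\<close>

lemma Iisg_mult_closed:
  assumes "p' \<in> carrier (Iisg G)" "p \<in> carrier (Iisg G)"
  shows "p' \<otimes>\<^bsub>Iisg G\<^esub> p \<in> carrier (Iisg G)"
proof -
  obtain f g f' g' where p: "p = (f, g)" "p' = (f', g')" by fastforce
  have "(f, g) \<in> carrier (Iisg G)" "(f', g') \<in> carrier (Iisg G)" using assms p by auto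
  then have f: "dom f \<subseteq> verts G" "inj_on f (dom f)" "inj_on g (dom g)"
    and g: "dom g = {e \<in> edges G. ends G e \<subseteq> dom f}"
      "ran g = {e \<in> edges G. ends G e \<subseteq> ran f}"
    and fg: "\<And>e e'. g e = Some e' \<Longrightarrow> ends G e' = (\<lambda>v. the (f v)) ` ends G e"
    and f': "ran f' \<subseteq> verts G" "inj_on f' (dom f')" "inj_on g' (dom g')"
    and g': "dom g' = {e \<in> edges G. ends G e \<subseteq> dom f'}"
      "ran g' = {e \<in> edges G. ends G e \<subseteq> ran f'}"
    and fg': "\<And>e e'. g' e = Some e' \<Longrightarrow> ends G e' = (\<lambda>v. the (f' v)) ` ends G e"
    by (auto simp: Iisg_carrier_iff)
  let ?f = "f' \<circ>\<^sub>m f" and ?g = "g' \<circ>\<^sub>m g"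
  have dom_f: "v \<in> dom ?f \<longleftrightarrow> v \<in> dom f \<and> the (f v) \<in> dom f'" for v
    by (auto simp: dom_def map_comp_def split: option.splits)
  have dom_g: "e \<in> dom ?g \<longleftrightarrow> e \<in> dom g \<and> the (g e) \<in> dom g'" for e
    by (auto simp: dom_def map_comp_def split: option.splits)
  have ends_in_dom: "ends G e \<subseteq> dom f" if "g e = Some e'" for e e'
    using that g(1) by blast
  have ends_in_dom': "ends G e \<subseteq> dom f'" if "g' e = Some e'" for e e'
    using that g'(1) by blast
  have ran_g_edges: "e' \<in> edges G" if "g e = Some e'" for e e'
    using that g(2) by (blast intro: ranI)
  have domg: "dom ?g = {e \<in> edges G. ends G e \<subseteq> dom ?f}"
  proof (rule Set.set_eqI)
    fix e
    show "e \<in> dom ?g \<longleftrightarrow> e \<in> {e \<in> edges G. ends G e \<subseteq> dom ?f}"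
    proof (cases "e \<in> dom g")
      case True
      then obtain e1 where e1: "g e = Some e1" by auto
      \<comment> \<open>The ends of \<open>e1\<close> are the images under \<open>f\<close> of the
        ends of \<open>e\<close>, so they lie in \<open>dom f'\<close> exactly when the ends of
        \<open>e\<close> survive the composition.\<close>
      have "e \<in> dom ?g \<longleftrightarrow> ends G e1 \<subseteq> dom f'"
        using dom_g[of e] True e1 ran_g_edges[OF e1] by (simp add: g'(1))
      also have "\<dots> \<longleftrightarrow> ends G e \<subseteq> dom ?f"
        unfolding fg[OF e1] using ends_in_dom[OF e1] dom_f by blast
      finally show ?thesis using True g(1) by auto
    next
      case False
      moreover have "dom ?f \<subseteq> dom f" using dom_f by blast
      ultimately show ?thesis using dom_g[of e] unfolding g(1) by blast
    qed
  qed
  have ends_comp: "ends G e'' = (\<lambda>v. the (?f v)) ` ends G e" if comp: "?g e = Some e''" for e e''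
  proof -
    obtain e' where e': "g e = Some e'" "g' e' = Some e''"
      using comp by (auto simp: map_comp_Some_iff)
    have "ends G e'' = (\<lambda>v. the (f' (the (f v)))) ` ends G e"
      unfolding fg'[OF e'(2)] fg[OF e'(1)] image_image ..
    \<comment> \<open>The two expressions agree only where \<open>f\<close> is defined, which holds
      at every end of \<open>e\<close>.\<close>
    also have "\<dots> = (\<lambda>v. the (?f v)) ` ends G e"
      using ends_in_dom[OF e'(1)] by (intro image_cong) (auto simp: map_comp_def)
    finally show ?thesis .
  qed
  have rang: "ran ?g = {e \<in> edges G. ends G e \<subseteq> ran ?f}"
  proof (intro equalityI subsetI)
    fix e'' assume "e'' \<in> ran ?g"
    then obtain e where e: "?g e = Some e''" by (auto simp: ran_def)
    have "e'' \<in> edges G" using e g'(2) by (auto simp: map_comp_Some_iff intro: ranI)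
    moreover have "ends G e \<subseteq> dom ?f" using e domg by blast
    then have "ends G e'' \<subseteq> ran ?f"
      unfolding ends_comp[OF e] by (force intro: ranI)
    ultimately show "e'' \<in> {e \<in> edges G. ends G e \<subseteq> ran ?f}" by simp
  next
    fix e'' assume "e'' \<in> {e \<in> edges G. ends G e \<subseteq> ran ?f}"
    then have e'': "e'' \<in> edges G" "ends G e'' \<subseteq> ran ?f" by auto
    have "ran ?f \<subseteq> ran f'" by (auto simp: ran_def map_comp_Some_iff)
    then have "e'' \<in> ran g'" using e'' g'(2) by auto
    then obtain e' where e': "g' e' = Some e''" by (auto simp: ran_def)
    \<comment> \<open>To pull \<open>e'\<close> back through \<open>g\<close>, its ends must lie in
      \<open>ran f\<close>. The image \<open>w\<close> of \<open>v\<close> is an end of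
      \<open>e''\<close>, hence also the image of some \<open>u'\<close> in \<open>ran f\<close>;
      injectivity of \<open>f'\<close> gives \<open>v = u'\<close>.\<close>
    have "v \<in> ran f" if v: "v \<in> ends G e'" for v
    proof -
      obtain w where w: "f' v = Some w" using v ends_in_dom'[OF e'] by blast
      then have "w \<in> ends G e''" using v fg'[OF e'] by force
      then obtain u u' where "f u = Some u'" "f' u' = Some w"
        using e''(2) by (auto simp: ran_def map_comp_Some_iff)
      then show ?thesis
        using w f'(2) by (metis domI inj_onD ranI)
    qed
    then have "e' \<in> ran g" using g(2) g'(1) e' by blast
    then show "e'' \<in> ran ?g" using e' by (auto simp: ran_def map_comp_Some_iff)
  qed
  have "dom ?f \<subseteq> verts G" using dom_f f(1) by blast
  moreover have "ran ?f \<subseteq> verts G"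
    using f'(1) by (auto simp: ran_def map_comp_Some_iff)
  ultimately have "(?f, ?g) \<in> carrier (Iisg G)"
    unfolding Iisg_carrier_iff
    using inj_on_map_comp[OF f(2) f'(2)] inj_on_map_comp[OF f(3) f'(3)] domg rang ends_comp
    by blast
  then show ?thesis by (simp add: p Iisg_mult)
qed

section \<open>The empty map, the identity, and failure of atomicity\<close>

context finite_multigraph
begin

text \<open>Every edge has at least one end, so the subgraph induced on the empty vertex set has no
  edges.\<close>

lemma empty_map_in_Iisg: "(Map.empty, Map.empty) \<in> carrier (Iisg G)"
  using ends_card by (fastforce simp: Iisg_carrier_iff)

text \<open>Supplies a member of the semigroup that differs from the empty map once there is a
  vertex. All ends lie in \<open>verts G\<close>, so the subgraph induced on \<open>verts G\<close>
  keeps every edge.\<close>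

lemma one_in_Iisg: "\<one>\<^bsub>Iisg G\<^esub> \<in> carrier (Iisg G)"
proof -
  have ran: "ran (Some |` A) = A" for A :: "'c set"
    by (auto simp: ran_def restrict_map_def)
  have inj: "inj_on (Some |` A) A" for A :: "'c set"
    by (simp add: inj_on_def)
  have "(\<lambda>v. the ((Some |` verts G) v)) ` ends G e = ends G e" if "e \<in> edges G" for e
    using ends_subset[OF that] by (force simp: restrict_map_def image_iff)
  then have "\<forall>e e'. (Some |` edges G) e = Some e' \<longrightarrow>
      ends G e' = (\<lambda>v. the ((Some |` verts G) v)) ` ends G e"
    by (auto simp: restrict_map_def)
  then have "(Some |` verts G, Some |` edges G) \<in> carrier (Iisg G)"
    by (auto simp: Iisg_carrier_iff ran inj dest: ends_subset[THEN subsetD])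
  then show ?thesis by (simp add: Iisg_def)
qed

lemma not_atomic_Iisg:
  assumes "verts G \<noteq> {}"
  shows "\<not> atomic (ideal_poset (Iisg G))"
proof (rule not_atomic_ideal_poset_if_zero)
  show "semigroup_ideal (Iisg G) (carrier (Iisg G))"
    by (simp add: semigroup_ideal_def Iisg_mult_closed)
  have zero: "x \<otimes>\<^bsub>Iisg G\<^esub> (Map.empty, Map.empty) = (Map.empty, Map.empty)"
    "(Map.empty, Map.empty) \<otimes>\<^bsub>Iisg G\<^esub> x = (Map.empty, Map.empty)" for x
    by (cases x; simp add: Iisg_mult map_comp_def fun_eq_iff split: option.splits)+
  then show "semigroup_ideal (Iisg G) {(Map.empty, Map.empty)}"
    using empty_map_in_Iisg by (simp add: semigroup_ideal_def)
  show "(Map.empty, Map.empty) \<otimes>\<^bsub>Iisg G\<^esub> x = (Map.empty, Map.empty)" for x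
    by (rule zero)
  show "\<one>\<^bsub>Iisg G\<^esub> \<in> carrier (Iisg G)" by (rule one_in_Iisg)
  show "\<one>\<^bsub>Iisg G\<^esub> \<noteq> (Map.empty, Map.empty)"
    using assms by (auto simp: Iisg_def restrict_map_def fun_eq_iff)
qed

end

theorem theorem4p19:
  fixes G :: "('v, 'e) multigraph"
  assumes "finite_multigraph G"
  shows "semimodular_lattice (ideal_poset (Iisg G)) \<and>
         (card (verts G) > 2 \<longrightarrow> \<not> atomic (ideal_poset (Iisg G)))"
  using semimodular_ideal_poset finite_multigraph.not_atomic_Iisg[OF assms] by fastforce

end
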